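(* Fix a positive integer $n$. The array $\left\{\binom{m,n}{k} : m,k=0,1,\ldots\right\}$ is a Pascal trapeze, that is, for all integers $m\ge1$, $k\ge 1$, $$\binom{m,\,n}{k}=\binom{m-1,\,n}{k-1}+\binom{m-1,\,n}{k}.$$ Moreover, the elements of its leftmost diagonal equal $2^n$, i.e. $\binom{m,n}{0}=2^n$ for all $m\ge 0$; its rightmost diagonal consists of ones, i.e. $\binom{m,n}{m+n}=1$ for all $m\ge0$; and its first row ($m=0$) consists of the numbers $\binom{0,n}{k}=2^{n-k}\binom{n}{k}$, $k=0,1,\ldots,n$.
   Context: For nonnegative integers $m,n,k$, let $X$ be a set that is the disjoint union of blocks $X_1,\dots,X_n,Y$ with $|X_i|=2$ for $i=1,\dots,n$ and $|Y|=m$. The number $\binom{m,n}{k}$ (two entries on top) is defined as the number of $(n+k)$-element subsets of $X$ that intersect each block $X_i$, $i=1,\dots,n$ (such subsets are called $(n+k)$-insets of $X$). The symbol $\binom{n}{k}$ (one entry on top) is the ordinary binomial coefficient. Rows of the array are indexed by $m$; the leftmost diagonal is formed by the entries with $k=0$ and the rightmost diagonal by the entries with $k=m+n$. *)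

theory Defs
  imports "HOL-Library.Disjoint_Sets"
begin

definition block_system :: "nat \<Rightarrow> nat \<Rightarrow> (nat \<Rightarrow> 'a set) \<Rightarrow> 'a set \<Rightarrow> bool" where
  "block_system m n B Y \<longleftrightarrow>
     disjoint_family_on B {1..n} \<and> (\<forall>i\<in>{1..n}. card (B i) = 2) \<and>
     finite Y \<and> card Y = m \<and> (\<forall>i\<in>{1..n}. B i \<inter> Y = {})"

definition insets :: "nat \<Rightarrow> nat \<Rightarrow> (nat \<Rightarrow> 'a set) \<Rightarrow> 'a set \<Rightarrow> 'a set set" where
  "insets n k B Y =
     {S. S \<subseteq> (\<Union>i\<in>{1..n}. B i) \<union> Y \<and> card S = n + k \<and> (\<forall>i\<in>{1..n}. S \<inter> B i \<noteq> {})}"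

text \<open>
  The number of insets does not depend on the choice of the block system (see
  \<open>card_insets_eq_inset_number\<close> below), so it is defined by means of one particular system
  for each m and n.
\<close>

definition std_block :: "nat \<Rightarrow> (nat \<times> nat) set" where
  "std_block i = {(i, 0), (i, 1)}"

definition std_rest :: "nat \<Rightarrow> (nat \<times> nat) set" where
  "std_rest m = {0} \<times> {..<m}"

definition inset_number :: "nat \<Rightarrow> nat \<Rightarrow> nat \<Rightarrow> nat" where
  "inset_number m n k = card (insets n k std_block (std_rest m))"

lemma block_system_std: "block_system m n std_block (std_rest m)"
  by (auto simp: block_system_def std_block_def std_rest_def disjoint_family_on_def
      card_cartesian_product)

lemma card_insets_le:
  fixes B :: "nat \<Rightarrow> 'a set" and B' :: "nat \<Rightarrow> 'b set"
  assumes BY: "block_system m n B Y" and BY': "block_system m n B' Y'"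
  shows "card (insets n k B Y) \<le> card (insets n k B' Y')"
proof -
  define Z where "Z i = (if i = 0 then Y else B i)" for i
  define Z' where "Z' i = (if i = 0 then Y' else B' i)" for i
  have cards: "finite (Z i) \<and> finite (Z' i) \<and> card (Z i) = card (Z' i)" if "i \<le> n" for i
  proof (cases "i = 0")
    case True
    then show ?thesis using BY BY' by (auto simp: Z_def Z'_def block_system_def)
  next
    case False
    then have "card (B i) = 2" "card (B' i) = 2"
      using BY BY' that by (auto simp: block_system_def)
    then show ?thesis
      using False by (auto simp: Z_def Z'_def intro!: card_ge_0_finite)
  qed
  have "\<forall>i\<in>{..n}. \<exists>h. bij_betw h (Z i) (Z' i)"
    using cards finite_same_card_bij by blast
  then obtain g where g: "\<And>i. i \<le> n \<Longrightarrow> bij_betw (g i) (Z i) (Z' i)"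
    by (metis atMost_iff)
  have disjoint: "i = j" if "x \<in> Z i" "x \<in> Z j" "i \<le> n" "j \<le> n" for x i j
    using that BY
    by (fastforce simp: Z_def block_system_def disjoint_family_on_def split: if_splits)
  have disjoint': "i = j" if "x \<in> Z' i" "x \<in> Z' j" "i \<le> n" "j \<le> n" for x i j
    using that BY'
    by (fastforce simp: Z'_def block_system_def disjoint_family_on_def split: if_splits)
  define f where "f x = g (THE i. i \<le> n \<and> x \<in> Z i) x" for x
  have f_eq: "f x = g i x" if "x \<in> Z i" "i \<le> n" for x i
  proof -
    have "(THE i. i \<le> n \<and> x \<in> Z i) = i"
      using that disjoint by (intro the_equality) auto
    then show ?thesis by (simp add: f_def)
  qed
  have f_bij: "bij_betw f (Z i) (Z' i)" if "i \<le> n" for i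
    using bij_betw_cong[of "Z i" f "g i"] f_eq g that by blast
  have union: "(\<Union>i\<in>{1..n}. B i) \<union> Y = (\<Union>i\<in>{..n}. Z i)"
    by (force simp: Z_def split: if_splits)
  have union': "(\<Union>i\<in>{1..n}. B' i) \<union> Y' = (\<Union>i\<in>{..n}. Z' i)"
    by (force simp: Z'_def split: if_splits)
  have inj: "inj_on f (\<Union>i\<in>{..n}. Z i)"
  proof (rule inj_onI)
    fix x y assume "x \<in> (\<Union>i\<in>{..n}. Z i)" "y \<in> (\<Union>i\<in>{..n}. Z i)" and eq: "f x = f y"
    then obtain i j where ij: "x \<in> Z i" "y \<in> Z j" "i \<le> n" "j \<le> n" by auto
    then have "f x \<in> Z' i" "f y \<in> Z' j" using f_bij by (auto simp: bij_betw_def)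
    then have "i = j" using eq disjoint' ij by simp
    then show "x = y" using f_bij[of i] ij eq by (auto simp: bij_betw_def inj_on_def)
  qed
  have maps: "f ` S \<in> insets n k B' Y'" if S: "S \<in> insets n k B Y" for S
  proof -
    have sub: "S \<subseteq> (\<Union>i\<in>{..n}. Z i)" using S union by (simp add: insets_def)
    have "f ` S \<subseteq> (\<Union>i\<in>{..n}. Z' i)"
      using sub f_bij by (fastforce simp: bij_betw_def)
    moreover have "card (f ` S) = n + k"
      using S card_image[OF inj_on_subset[OF inj sub]] by (simp add: insets_def)
    moreover have "f ` S \<inter> B' i \<noteq> {}" if i: "i \<in> {1..n}" for i
    proof -
      obtain x where "x \<in> S" "x \<in> B i" using S i unfolding insets_def by blast
      then have "f x \<in> B' i"
        using f_bij[of i] i by (auto simp: Z_def Z'_def bij_betw_def)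
      with \<open>x \<in> S\<close> show ?thesis by blast
    qed
    ultimately show ?thesis using union' by (simp add: insets_def)
  qed
  show ?thesis
  proof (rule card_inj_on_le)
    show "inj_on ((`) f) (insets n k B Y)"
      using inj union by (auto simp: insets_def inj_on_image_eq_iff intro!: inj_onI)
    show "(`) f ` insets n k B Y \<subseteq> insets n k B' Y'"
      using maps by blast
    have "finite (\<Union>i\<in>{..n}. Z' i)" using cards by blast
    then show "finite (insets n k B' Y')"
      using union' by (auto simp: insets_def intro: finite_subset[of _ "Pow (\<Union>i\<in>{..n}. Z' i)"])
  qed
qed

lemma card_insets_eq_inset_number:
  assumes "block_system m n B Y"
  shows "card (insets n k B Y) = inset_number m n k"
  unfolding inset_number_def
  using card_insets_le[OF assms block_system_std] card_insets_le[OF block_system_std assms]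
  by (rule order.antisym)

end

theory Submission
  imports Defs
begin

text \<open>
  The idea is to move points in and out of the free part \<open>Y\<close>, using that the number of insets
  depends only on \<open>m\<close> and \<open>n\<close>, not on the block system.

  Splitting the insets according to whether they contain a given point \<open>p\<close> of \<open>Y\<close> gives the
  Pascal rule (\<open>inset_number_pascal\<close>), because removing \<open>p\<close> does not affect which blocks are
  met. For \<open>k = 0\<close> the insets containing \<open>p\<close> disappear: \<open>n\<close> elements are all used up in
  meeting the \<open>n\<close> disjoint blocks. Hence \<open>inset_number m n 0\<close> does not depend on \<open>m\<close>
  (\<open>inset_number_0_Suc\<close>).

  There is also a recurrence in \<open>n\<close>. If a block is dissolved into two free points, then the insets
  of the new system are those which still meet the old block, and those which avoid it
  (\<open>inset_number_dissolve_block\<close>). Combining this with two applications of the Pascal rule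
  yields
  \<open>inset_number m (n + 1) (k + 1) = inset_number m n k + 2 * inset_number m n (k + 1)\<close>, and the
  same without its first summand for \<open>k + 1\<close> replaced by \<open>0\<close>. These recurrences give the leftmost
  diagonal and the first row by induction on \<open>n\<close>. On the rightmost diagonal the whole set
  is the only candidate.
\<close>

section \<open>Block systems and their ground sets\<close>

lemma block_system_finite:
  assumes "block_system m n B Y"
  shows "finite ((\<Union>i\<in>{1..n}. B i) \<union> Y)"
  using assms by (auto simp: block_system_def intro!: card_ge_0_finite)

lemma block_system_card:
  assumes "block_system m n B Y"
  shows "card ((\<Union>i\<in>{1..n}. B i) \<union> Y) = m + 2 * n"
proof -
  have fin: "finite (\<Union>i\<in>{1..n}. B i)" "finite Y"
    using block_system_finite[OF assms] by auto
  have "card (\<Union>i\<in>{1..n}. B i) = (\<Sum>i\<in>{1..n}. card (B i))"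
    using assms fin(1)
    by (intro card_UN_disjoint) (auto simp: block_system_def disjoint_family_on_def)
  also have "\<dots> = 2 * n"
    using assms by (simp add: block_system_def)
  finally show ?thesis
    using assms fin by (subst card_Un_disjoint) (auto simp: block_system_def)
qed

lemma insets_finite:
  assumes "block_system m n B Y"
  shows "finite (insets n k B Y)"
  by (rule finite_subset[of _ "Pow ((\<Union>i\<in>{1..n}. B i) \<union> Y)"])
    (use block_system_finite[OF assms] in \<open>auto simp: insets_def\<close>)

lemma card_meeting_blocks_ge:
  assumes disj: "disjoint_family_on B {1..n}" and "finite S"
    and meets: "\<forall>i\<in>{1..n}. S \<inter> B i \<noteq> {}"
  shows "n \<le> card (S \<inter> (\<Union>i\<in>{1..n}. B i))"
proof -
  have "n = (\<Sum>i\<in>{1..n}. 1)" by simp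
  also have "\<dots> \<le> (\<Sum>i\<in>{1..n}. card (S \<inter> B i))"
    using meets \<open>finite S\<close> by (intro sum_mono) (simp add: Suc_le_eq card_gt_0_iff)
  also have "\<dots> = card (\<Union>i\<in>{1..n}. S \<inter> B i)"
    using disj \<open>finite S\<close>
    by (intro card_UN_disjoint[symmetric]) (auto simp: disjoint_family_on_def)
  also have "(\<Union>i\<in>{1..n}. S \<inter> B i) = S \<inter> (\<Union>i\<in>{1..n}. B i)" by blast
  finally show ?thesis .
qed

section \<open>Adding a free point\<close>

lemma block_system_insert:
  assumes "block_system m n B Y" and "p \<notin> (\<Union>i\<in>{1..n}. B i) \<union> Y"
  shows "block_system (Suc m) n B (insert p Y)"
  using assms by (auto simp: block_system_def)

lemma insets_insert:
  assumes BY: "block_system m n B Y" and p: "p \<notin> (\<Union>i\<in>{1..n}. B i) \<union> Y"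
  shows "insets n (Suc k) B (insert p Y) = insets n (Suc k) B Y \<union> insert p ` insets n k B Y"
    (is "?L = ?R")
proof
  show "?L \<subseteq> ?R"
  proof
    fix S assume S: "S \<in> ?L"
    show "S \<in> ?R"
    proof (cases "p \<in> S")
      case True
      then have "S - {p} \<in> insets n k B Y"
        using S p by (auto simp: insets_def card_Diff_singleton)
      moreover have "S = insert p (S - {p})" using True by blast
      ultimately show ?thesis by blast
    next
      case False
      then show ?thesis using S by (auto simp: insets_def)
    qed
  qed
  have "insert p T \<in> ?L" if T: "T \<in> insets n k B Y" for T
  proof -
    have sub: "T \<subseteq> (\<Union>i\<in>{1..n}. B i) \<union> Y" using T by (simp add: insets_def)
    then have "finite T" "p \<notin> T"
      using block_system_finite[OF BY] p by (auto intro: finite_subset)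
    then show ?thesis using T by (auto simp: insets_def)
  qed
  then show "?R \<subseteq> ?L" by (auto simp: insets_def)
qed

lemma card_insets_insert:
  assumes BY: "block_system m n B Y" and p: "p \<notin> (\<Union>i\<in>{1..n}. B i) \<union> Y"
  shows "card (insets n (Suc k) B (insert p Y)) = card (insets n k B Y) + card (insets n (Suc k) B Y)"
proof -
  have avoid: "p \<notin> S" if "S \<in> insets n j B Y" for S j
    using that p by (auto simp: insets_def)
  have "inj_on (insert p) (insets n k B Y)"
    using avoid by (meson inj_onI insert_ident)
  moreover have "insets n (Suc k) B Y \<inter> insert p ` insets n k B Y = {}"
    using avoid by blast
  ultimately show ?thesis
    unfolding insets_insert[OF BY p]
    by (simp add: card_Un_disjoint card_image insets_finite[OF BY])
qed

lemma std_point_fresh: "(0, m) \<notin> (\<Union>i\<in>{1..n}. std_block i) \<union> std_rest m"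
  by (auto simp: std_block_def std_rest_def)

lemma inset_number_pascal:
  "inset_number (Suc m) n (Suc k) = inset_number m n k + inset_number m n (Suc k)"
proof -
  have "inset_number (Suc m) n (Suc k)
      = card (insets n (Suc k) std_block (insert (0, m) (std_rest m)))"
    by (rule card_insets_eq_inset_number[symmetric])
      (rule block_system_insert[OF block_system_std std_point_fresh])
  then show ?thesis
    by (simp only: card_insets_insert[OF block_system_std std_point_fresh] inset_number_def)
qed

text \<open>
  If an inset contained a point \<open>p\<close> outside the blocks, then at most \<open>n - 1\<close> of its \<open>n\<close>
  elements would be left to meet \<open>n\<close> disjoint blocks.
\<close>

lemma insets_0_subset_blocks:
  assumes BY: "block_system m n B Y" and S: "S \<in> insets n 0 B Y"
  shows "S \<subseteq> (\<Union>i\<in>{1..n}. B i)"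
proof -
  have "finite S"
    using S block_system_finite[OF BY] by (auto simp: insets_def intro: finite_subset)
  moreover from this have "card S \<le> card (S \<inter> (\<Union>i\<in>{1..n}. B i))"
    using S BY card_meeting_blocks_ge[of B n S] by (simp add: insets_def block_system_def)
  ultimately have "S \<inter> (\<Union>i\<in>{1..n}. B i) = S"
    by (intro card_seteq) auto
  then show ?thesis by blast
qed

lemma inset_number_0_Suc: "inset_number (Suc m) n 0 = inset_number m n 0"
proof -
  have "S \<in> insets n 0 std_block (std_rest (Suc m)) \<longleftrightarrow> S \<in> insets n 0 std_block (std_rest m)"
    for S
    using insets_0_subset_blocks[OF block_system_std, of S n "Suc m"]
      insets_0_subset_blocks[OF block_system_std, of S n m]
    by (simp only: insets_def mem_Collect_eq) blast
  then have "insets n 0 std_block (std_rest (Suc m)) = insets n 0 std_block (std_rest m)"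
    by blast
  then show ?thesis by (simp only: inset_number_def)
qed

section \<open>Dissolving a block\<close>

text \<open>
  All three families consist of sets with \<open>n + 1 + k\<close> elements, and the two on the right are told
  apart by whether a set meets the block \<open>B (Suc n)\<close>. Declaring its points free
  lowers the number of blocks by one, which is why the excess over this number rises from \<open>k\<close> to \<open>k + 1\<close>.
\<close>

lemma insets_dissolve_block:
  assumes "B (Suc n) \<inter> ((\<Union>i\<in>{1..n}. B i) \<union> Y) = {}"
  shows "insets n (Suc k) B (B (Suc n) \<union> Y) = insets (Suc n) k B Y \<union> insets n (Suc k) B Y"
    and "insets (Suc n) k B Y \<inter> insets n (Suc k) B Y = {}"
proof -
  have blocks: "{1..Suc n} = insert (Suc n) {1..n}" by auto
  have "S \<in> insets n (Suc k) B (B (Suc n) \<union> Y)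
      \<longleftrightarrow> S \<in> insets (Suc n) k B Y \<union> insets n (Suc k) B Y"
    for S
  proof (cases "S \<inter> B (Suc n) = {}")
    case True
    then have "S \<subseteq> (\<Union>i\<in>{1..n}. B i) \<union> (B (Suc n) \<union> Y) \<longleftrightarrow> S \<subseteq> (\<Union>i\<in>{1..n}. B i) \<union> Y"
      by blast
    with True show ?thesis
      unfolding insets_def blocks by (simp del: UN_simps)
  next
    case False
    then have "\<not> S \<subseteq> (\<Union>i\<in>{1..n}. B i) \<union> Y"
      using assms by blast
    with False show ?thesis
      unfolding insets_def blocks by (simp add: Un_ac del: UN_simps)
  qed
  then show "insets n (Suc k) B (B (Suc n) \<union> Y) = insets (Suc n) k B Y \<union> insets n (Suc k) B Y"
    by blast
  show "insets (Suc n) k B Y \<inter> insets n (Suc k) B Y = {}"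
  proof -
    have "S \<inter> B (Suc n) \<noteq> {}" if "S \<in> insets (Suc n) k B Y" for S
      using that by (simp add: insets_def)
    moreover have "S \<inter> B (Suc n) = {}" if "S \<in> insets n (Suc k) B Y" for S
    proof -
      have "S \<subseteq> (\<Union>i\<in>{1..n}. B i) \<union> Y"
        using that by (simp only: insets_def mem_Collect_eq)
      then show ?thesis using assms by blast
    qed
    ultimately show ?thesis by blast
  qed
qed

lemma inset_number_dissolve_block:
  "inset_number (m + 2) n (Suc k) = inset_number m (Suc n) k + inset_number m n (Suc k)"
proof -
  let ?Y = "std_block (Suc n) \<union> std_rest m"
  have fresh: "std_block (Suc n) \<inter> ((\<Union>i\<in>{1..n}. std_block i) \<union> std_rest m) = {}"
    by (auto simp: std_block_def std_rest_def)
  then have "card ?Y = 2 + m"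
    by (subst card_Un_disjoint) (auto simp: std_block_def std_rest_def)
  then have "block_system (m + 2) n std_block ?Y"
    using block_system_std[of m n] fresh
    by (auto simp: block_system_def std_block_def)
  then have "inset_number (m + 2) n (Suc k) = card (insets n (Suc k) std_block ?Y)"
    by (simp only: card_insets_eq_inset_number)
  also have "\<dots> = inset_number m (Suc n) k + inset_number m n (Suc k)"
    unfolding insets_dissolve_block(1)[OF fresh] inset_number_def
    by (intro card_Un_disjoint insets_finite[OF block_system_std] insets_dissolve_block(2) fresh)
  finally show ?thesis .
qed

lemma inset_number_Suc_0: "inset_number m (Suc n) 0 = 2 * inset_number m n 0"
  using inset_number_dissolve_block[of m n 0]
  by (simp add: inset_number_pascal inset_number_0_Suc)

lemma inset_number_Suc_Suc:
  "inset_number m (Suc n) (Suc k) = inset_number m n k + 2 * inset_number m n (Suc k)"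
  using inset_number_dissolve_block[of m n "Suc k"]
  by (simp add: inset_number_pascal)

section \<open>The border of the trapeze\<close>

lemma inset_number_0_0: "inset_number 0 0 k = (if k = 0 then 1 else 0)"
proof -
  have "insets 0 k std_block (std_rest 0) = (if k = 0 then {{}} else {})"
    by (auto simp: insets_def std_rest_def)
  then show ?thesis by (simp add: inset_number_def)
qed

lemma inset_number_leftmost: "inset_number m n 0 = 2 ^ n"
proof (induction n)
  case 0
  show ?case
    by (induction m) (simp_all add: inset_number_0_0 inset_number_0_Suc)
qed (simp add: inset_number_Suc_0)

lemma inset_number_rightmost: "inset_number m n (m + n) = 1"
proof -
  let ?X = "(\<Union>i\<in>{1..n}. std_block i) \<union> std_rest m"
  have fin: "finite ?X" and card: "card ?X = n + (m + n)"
    using block_system_finite[OF block_system_std] block_system_card[OF block_system_std] by auto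
  have "insets n (m + n) std_block (std_rest m) = {?X}"
  proof
    show "insets n (m + n) std_block (std_rest m) \<subseteq> {?X}"
    proof
      fix S assume "S \<in> insets n (m + n) std_block (std_rest m)"
      then have "S \<subseteq> ?X" "card S = card ?X"
        unfolding card by (simp_all only: insets_def mem_Collect_eq)
      then show "S \<in> {?X}" using card_subset_eq[OF fin] by blast
    qed
    show "{?X} \<subseteq> insets n (m + n) std_block (std_rest m)"
      using card unfolding insets_def by (auto simp: std_block_def)
  qed
  then show ?thesis by (simp add: inset_number_def)
qed

lemma inset_number_first_row: "inset_number 0 n k = 2 ^ (n - k) * (n choose k)"
proof (induction n arbitrary: k)
  case 0
  show ?case by (simp add: inset_number_0_0)
next
  case (Suc n)
  show ?case
  proof (cases k)
    case 0
    then show ?thesis by (simp add: inset_number_leftmost)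
  next
    case (Suc j)
    (* For j >= n the truncated exponent n - Suc j is harmless: the binomial coefficient is 0. *)
    have "2 * (2 ^ (n - Suc j) * (n choose Suc j)) = 2 ^ (n - j) * (n choose Suc j)"
    proof (cases "j < n")
      case True
      then have "n - j = Suc (n - Suc j)" by simp
      then show ?thesis by simp
    qed simp
    then show ?thesis
      using Suc Suc.IH by (simp add: inset_number_Suc_Suc algebra_simps)
  qed
qed

theorem proposition4:
  fixes n :: nat
  assumes "n \<ge> 1"
  shows "(\<forall>m\<ge>1. \<forall>k\<ge>1.
            inset_number m n k = inset_number (m - 1) n (k - 1) + inset_number (m - 1) n k)
       \<and> (\<forall>m. inset_number m n 0 = 2 ^ n)
       \<and> (\<forall>m. inset_number m n (m + n) = 1)
       \<and> (\<forall>k\<in>{0..n}. inset_number 0 n k = 2 ^ (n - k) * (n choose k))"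
proof (intro conjI allI ballI impI)
  fix m k :: nat
  assume "m \<ge> 1" "k \<ge> 1"
  then show "inset_number m n k = inset_number (m - 1) n (k - 1) + inset_number (m - 1) n k"
    using inset_number_pascal[of "m - 1" n "k - 1"] by simp
qed (rule inset_number_leftmost inset_number_rightmost inset_number_first_row)+

end
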